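(* Let $\mathcal T$ be a triangulation of a manifold, with vertex set $\mathcal T_0$ and edge set $\mathcal T_1$. The map $(\mathcal T,w,c)\mapsto(\mathcal T,\ell,w)$, $\ell_{ij}=\sqrt{w_i+w_j-c_{ij}}$, is a bijection from the set of Thurston triangulations on $\mathcal T$ to the set of weighted triangulations on $\mathcal T$.
   Context: $\mathcal T$ is a topological (simplicial) triangulation of an $n$-dimensional manifold. A Euclidean triangulation $(\mathcal T,\ell)$ is an assignment $\ell:\mathcal T_1\to(0,\infty)$ such that for each simplex of $\mathcal T$ there exists a (nondegenerate) Euclidean simplex with the assigned edge lengths. A weighted triangulation $(\mathcal T,\ell,w)$ is a Euclidean triangulation $(\mathcal T,\ell)$ together with a function $w:\mathcal T_0\to\mathbb R$. A Thurston triangulation is a triple $(\mathcal T,w,c)$ with $w:\mathcal T_0\to\mathbb R$ and $c:\mathcal T_1\to\mathbb R$ such that $c_{ij}<w_i+w_j$ for each edge $\{i,j\}$ and such that the induced lengths $\ell_{ij}=\sqrt{w_i+w_j-c_{ij}}$ make $(\mathcal T,\ell)$ a Euclidean triangulation. *)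

theory Defs
  imports "HOL-Analysis.Analysis"
begin

text \<open>A simplex of an abstract simplicial complex is its (finite, nonempty) set of vertices.\<close>

definition abstract_simplicial_complex :: "'a set set \<Rightarrow> bool" where
  "abstract_simplicial_complex T \<longleftrightarrow>
     (\<forall>\<sigma>\<in>T. finite \<sigma> \<and> \<sigma> \<noteq> {}) \<and> (\<forall>\<sigma>\<in>T. \<forall>\<tau>. \<tau> \<subseteq> \<sigma> \<and> \<tau> \<noteq> {} \<longrightarrow> \<tau> \<in> T)"

definition vertices :: "'a set set \<Rightarrow> 'a set" where
  "vertices T = {v. {v} \<in> T}"

definition edges :: "'a set set \<Rightarrow> 'a set set" where
  "edges T = {e \<in> T. card e = 2}"

text \<open>The geometric realization in barycentric coordinates, with the topology coherent with the
  closed simplices.\<close>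

definition closed_cell :: "'a set \<Rightarrow> ('a \<Rightarrow> real) set" where
  "closed_cell \<sigma> = {x. (\<forall>v. 0 \<le> x v) \<and> (\<forall>v. v \<notin> \<sigma> \<longrightarrow> x v = 0) \<and> (\<Sum>v\<in>\<sigma>. x v) = 1}"

definition realization :: "'a set set \<Rightarrow> ('a \<Rightarrow> real) topology" where
  "realization T = topology (\<lambda>U. U \<subseteq> (\<Union>\<sigma>\<in>T. closed_cell \<sigma>) \<and>
     (\<forall>\<sigma>\<in>T. openin (top_of_set (closed_cell \<sigma>)) (closed_cell \<sigma> \<inter> U)))"

lemma openin_realization:
  "openin (realization T) U \<longleftrightarrow> U \<subseteq> (\<Union>\<sigma>\<in>T. closed_cell \<sigma>) \<and>
     (\<forall>\<sigma>\<in>T. openin (top_of_set (closed_cell \<sigma>)) (closed_cell \<sigma> \<inter> U))"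
proof -
  have "istopology (\<lambda>U. U \<subseteq> (\<Union>\<sigma>\<in>T. closed_cell \<sigma>) \<and>
     (\<forall>\<sigma>\<in>T. openin (top_of_set (closed_cell \<sigma>)) (closed_cell \<sigma> \<inter> U)))"
    unfolding istopology_def
  proof (intro conjI allI impI ballI, goal_cases)
    case (2 S U \<sigma>)
    then have "openin (top_of_set (closed_cell \<sigma>)) (closed_cell \<sigma> \<inter> S)"
      and "openin (top_of_set (closed_cell \<sigma>)) (closed_cell \<sigma> \<inter> U)"
      by blast+
    then have "openin (top_of_set (closed_cell \<sigma>)) ((closed_cell \<sigma> \<inter> S) \<inter> (closed_cell \<sigma> \<inter> U))"
      by (rule openin_Int)
    moreover have "closed_cell \<sigma> \<inter> (S \<inter> U) = (closed_cell \<sigma> \<inter> S) \<inter> (closed_cell \<sigma> \<inter> U)"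
      by blast
    ultimately show ?case
      by (simp only:)
  next
    case (4 K \<sigma>)
    then have "\<forall>U\<in>K. openin (top_of_set (closed_cell \<sigma>)) (closed_cell \<sigma> \<inter> U)"
      by blast
    then have "openin (top_of_set (closed_cell \<sigma>)) (\<Union>U\<in>K. closed_cell \<sigma> \<inter> U)"
      by (intro openin_Union) blast
    moreover have "closed_cell \<sigma> \<inter> \<Union>K = (\<Union>U\<in>K. closed_cell \<sigma> \<inter> U)"
      by blast
    ultimately show ?case
      by (simp only:)
  qed blast+
  then show ?thesis
    by (simp add: realization_def)
qed

definition topological_manifold :: "nat \<Rightarrow> 'b topology \<Rightarrow> bool" where
  "topological_manifold n M \<longleftrightarrow> Hausdorff_space M \<and> second_countable M \<and>
     (\<forall>x\<in>topspace M. \<exists>U V. openin M U \<and> x \<in> U \<and> openin (Euclidean_space n) V \<and>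
        subtopology M U homeomorphic_space subtopology (Euclidean_space n) V)"

definition triangulates :: "'a set set \<Rightarrow> 'b topology \<Rightarrow> bool" where
  "triangulates T M \<longleftrightarrow>
     abstract_simplicial_complex T \<and> realization T homeomorphic_space M"

text \<open>Nondegenerate Euclidean simplices: \<open>p\<close> places the vertices of a \<open>k\<close>-simplex \<open>\<sigma>\<close> at affinely
  independent points of \<open>k\<close>-dimensional Euclidean space. The points are sequences vanishing from
  index \<open>k\<close> on, as in the library's \<open>Euclidean_space k\<close>, because \<open>k\<close> varies with \<open>\<sigma>\<close>; affine
  dependence and distance are therefore written out in coordinates.\<close>

definition affinely_independent_on :: "nat \<Rightarrow> 'a set \<Rightarrow> ('a \<Rightarrow> nat \<Rightarrow> real) \<Rightarrow> bool" where
  "affinely_independent_on k \<sigma> p \<longleftrightarrow>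
     (\<forall>u :: 'a \<Rightarrow> real. (\<Sum>v\<in>\<sigma>. u v) = 0 \<and> (\<forall>m<k. (\<Sum>v\<in>\<sigma>. u v * p v m) = 0)
        \<longrightarrow> (\<forall>v\<in>\<sigma>. u v = 0))"

definition euclidean_distance :: "nat \<Rightarrow> (nat \<Rightarrow> real) \<Rightarrow> (nat \<Rightarrow> real) \<Rightarrow> real" where
  "euclidean_distance k x y = L2_set (\<lambda>m. x m - y m) {..<k}"

definition euclidean_simplex_exists :: "'a set \<Rightarrow> ('a set \<Rightarrow> real) \<Rightarrow> bool" where
  "euclidean_simplex_exists \<sigma> l \<longleftrightarrow>
     (let k = card \<sigma> - 1 in
      \<exists>p. (\<forall>v\<in>\<sigma>. p v \<in> topspace (Euclidean_space k)) \<and>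
          affinely_independent_on k \<sigma> p \<and>
          (\<forall>i\<in>\<sigma>. \<forall>j\<in>\<sigma>. i \<noteq> j \<longrightarrow> euclidean_distance k (p i) (p j) = l {i, j}))"

text \<open>Functions on vertices and on edges are extensional, so that equality of functions is equality
  on their domain.\<close>

definition euclidean_triangulation :: "'a set set \<Rightarrow> ('a set \<Rightarrow> real) \<Rightarrow> bool" where
  "euclidean_triangulation T l \<longleftrightarrow>
     l \<in> edges T \<rightarrow>\<^sub>E {0<..} \<and> (\<forall>\<sigma>\<in>T. euclidean_simplex_exists \<sigma> l)"

definition weighted_triangulation ::
    "'a set set \<Rightarrow> ('a set \<Rightarrow> real) \<Rightarrow> ('a \<Rightarrow> real) \<Rightarrow> bool" where
  "weighted_triangulation T l w \<longleftrightarrow>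
     euclidean_triangulation T l \<and> w \<in> vertices T \<rightarrow>\<^sub>E UNIV"

text \<open>For an edge \<open>e = {i, j}\<close> the sum over \<open>e\<close> is \<open>w i + w j\<close>.\<close>

definition induced_length ::
    "'a set set \<Rightarrow> ('a \<Rightarrow> real) \<Rightarrow> ('a set \<Rightarrow> real) \<Rightarrow> 'a set \<Rightarrow> real" where
  "induced_length T w c = (\<lambda>e\<in>edges T. sqrt ((\<Sum>v\<in>e. w v) - c e))"

lemma induced_length_edge:
  assumes "{i, j} \<in> edges T"
  shows "induced_length T w c {i, j} = sqrt (w i + w j - c {i, j})"
proof -
  have "i \<noteq> j"
    using assms by (auto simp: edges_def)
  then show ?thesis
    using assms by (simp add: induced_length_def)
qed

definition thurston_triangulation ::
    "'a set set \<Rightarrow> ('a \<Rightarrow> real) \<Rightarrow> ('a set \<Rightarrow> real) \<Rightarrow> bool" where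
  "thurston_triangulation T w c \<longleftrightarrow>
     w \<in> vertices T \<rightarrow>\<^sub>E UNIV \<and> c \<in> edges T \<rightarrow>\<^sub>E UNIV \<and>
     (\<forall>i j. {i, j} \<in> edges T \<longrightarrow> c {i, j} < w i + w j) \<and>
     euclidean_triangulation T (induced_length T w c)"

end

theory Submission
  imports Defs
begin

text \<open>The vertex weights \<open>w\<close> are carried along unchanged, and for fixed \<open>w\<close> the relation
  \<open>l\<^sub>i\<^sub>j = sqrt (w\<^sub>i + w\<^sub>j - c\<^sub>i\<^sub>j)\<close> is inverted edge by edge by
  \<open>c\<^sub>i\<^sub>j = w\<^sub>i + w\<^sub>j - l\<^sub>i\<^sub>j\<^sup>2\<close>, since \<open>sqrt\<close> and squaring are mutually inverse on positive reals.\<close>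

definition induced_weight ::
    "'a set set \<Rightarrow> ('a set \<Rightarrow> real) \<Rightarrow> ('a \<Rightarrow> real) \<Rightarrow> 'a set \<Rightarrow> real" where
  "induced_weight T l w = (\<lambda>e\<in>edges T. (\<Sum>v\<in>e. w v) - (l e)\<^sup>2)"

text \<open>Rephrases the inequality for pairs \<open>i\<close>, \<open>j\<close> as one for edges
  \<open>e\<close>, so that it says that the radicand in \<open>induced_length\<close> is
  positive.\<close>

lemma thurston_triangulation_less:
  assumes "thurston_triangulation T w c" and "e \<in> edges T"
  shows "c e < (\<Sum>v\<in>e. w v)"
proof -
  obtain i j where "e = {i, j}" "i \<noteq> j"
    using assms(2) by (auto simp: edges_def card_2_iff)
  moreover have "\<forall>i j. {i, j} \<in> edges T \<longrightarrow> c {i, j} < w i + w j"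
    using assms(1) unfolding thurston_triangulation_def by blast
  ultimately show ?thesis
    using assms(2) by simp
qed

text \<open>On an edge, squaring undoes the root because the radicand is positive, and the vertex
  sums cancel.\<close>

lemma induced_weight_induced_length:
  assumes "thurston_triangulation T w c"
  shows "induced_weight T (induced_length T w c) w = c"
proof
  fix e
  show "induced_weight T (induced_length T w c) w e = c e"
  proof (cases "e \<in> edges T")
    case True
    then show ?thesis
      using thurston_triangulation_less[OF assms True]
      by (simp add: induced_weight_def induced_length_def)
  next
    case False
    \<comment> \<open>Off the edges both sides are \<open>undefined\<close>.\<close>
    have "c \<in> extensional (edges T)"
      using assms unfolding thurston_triangulation_def PiE_def by blast
    then show ?thesis
      using False by (simp add: induced_weight_def extensional_def)
  qed
qed

text \<open>The vertex sums cancel for any \<open>w\<close>, leaving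
  \<open>sqrt ((l e)\<^sup>2)\<close>, which is \<open>l e\<close> by positivity.\<close>

lemma induced_length_induced_weight:
  assumes "l \<in> edges T \<rightarrow>\<^sub>E {0<..}"
  shows "induced_length T w (induced_weight T l w) = l"
proof
  fix e
  show "induced_length T w (induced_weight T l w) e = l e"
  proof (cases "e \<in> edges T")
    case True
    then have "0 < l e"
      using assms by auto
    then show ?thesis
      using True by (simp add: induced_weight_def induced_length_def)
  next
    case False
    then have "l e = undefined"
      using assms by (rule PiE_arb[rotated])
    then show ?thesis
      using False by (simp add: induced_length_def)
  qed
qed

lemma weighted_triangulation_induced_length:
  assumes "thurston_triangulation T w c"
  shows "weighted_triangulation T (induced_length T w c) w"
  using assms by (simp add: thurston_triangulation_def weighted_triangulation_def)

lemma thurston_triangulation_induced_weight: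
  assumes "weighted_triangulation T l w"
  shows "thurston_triangulation T w (induced_weight T l w)"
proof -
  have w: "w \<in> vertices T \<rightarrow>\<^sub>E UNIV" and l: "euclidean_triangulation T l"
    using assms by (auto simp: weighted_triangulation_def)
  then have pos: "l \<in> edges T \<rightarrow>\<^sub>E {0<..}"
    by (simp add: euclidean_triangulation_def)
  have "induced_weight T l w {i, j} < w i + w j" if "{i, j} \<in> edges T" for i j
  proof -
    \<comment> \<open>If \<open>i = j\<close>, the sum over \<open>{i, j}\<close> would collapse to
      \<open>w i\<close>.\<close>
    have "i \<noteq> j"
      using that by (auto simp: edges_def)
    moreover have "0 < l {i, j}"
      using pos that by auto
    ultimately show ?thesis
      using that by (simp add: induced_weight_def)
  qed
  moreover have "induced_weight T l w \<in> edges T \<rightarrow>\<^sub>E UNIV"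
    by (simp add: induced_weight_def)
  \<comment> \<open>The lengths induced by the new \<open>c\<close> are \<open>l\<close> again, so
    the Euclidean condition is the one already known for \<open>l\<close>.\<close>
  ultimately show ?thesis
    using w l by (simp add: thurston_triangulation_def induced_length_induced_weight[OF pos])
qed

theorem theorem10:
  fixes n :: nat and M :: "'b topology" and T :: "'a set set"
  assumes "topological_manifold n M" and "triangulates T M"
  shows "bij_betw (\<lambda>(w, c). (induced_length T w c, w))
           {(w, c). thurston_triangulation T w c}
           {(l, w). weighted_triangulation T l w}"
\<comment> \<open>The inverse keeps \<open>w\<close> and recovers \<open>c\<close>; what remains are
  the two cancellation laws and the two inclusions of images.\<close>
proof (rule bij_betw_byWitness[where f' = "\<lambda>(l, w). (w, induced_weight T l w)"])
  show "\<forall>x\<in>{(w, c). thurston_triangulation T w c}.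
      (\<lambda>(l, w). (w, induced_weight T l w)) ((\<lambda>(w, c). (induced_length T w c, w)) x) = x"
    by (clarsimp simp: induced_weight_induced_length)
  show "\<forall>y\<in>{(l, w). weighted_triangulation T l w}.
      (\<lambda>(w, c). (induced_length T w c, w)) ((\<lambda>(l, w). (w, induced_weight T l w)) y) = y"
    \<comment> \<open>Unfolding the definitions exposes the positivity of \<open>l\<close>, the
      premise of the cancellation law.\<close>
    by (clarsimp simp: induced_length_induced_weight weighted_triangulation_def
        euclidean_triangulation_def)
  show "(\<lambda>(w, c). (induced_length T w c, w)) ` {(w, c). thurston_triangulation T w c}
      \<subseteq> {(l, w). weighted_triangulation T l w}"
    by (clarsimp simp: weighted_triangulation_induced_length)
  show "(\<lambda>(l, w). (w, induced_weight T l w)) ` {(l, w). weighted_triangulation T l w}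
      \<subseteq> {(w, c). thurston_triangulation T w c}"
    by (clarsimp simp: thurston_triangulation_induced_weight)
qed

end
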